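(* Let $m\ge1$ and suppose $X\subseteq\mathbb{N}^2$ is periodic modulo $m$ with indicator $f:(\mathbb{Z}/m\mathbb{Z})^2\to\{0,1\}$ (i.e. for all distinct $a,b\in\mathbb{N}$, $(a,b)\in X$ iff $f(a\bmod m,b\bmod m)=1$). Let $H$ be the directed graph on vertex set $\mathbb{Z}/m\mathbb{Z}$ with an edge $r\to s$ iff $f(r,s)=0$. For $n\ge1$ write $\ell_r(n)=|\{t\in[n]:t\equiv r\pmod m\}|$. For nonnegative integers $\ell_0,\dots,\ell_{m-1}$ with sum $n$, let $A_H(\ell_0,\dots,\ell_{m-1})$ be the number of words $w=w_1\cdots w_n$ over $\mathbb{Z}/m\mathbb{Z}$ with $|\{i:w_i=r\}|=\ell_r$ for all $r$ and such that $w_i\to w_{i+1}$ is an edge of $H$ for all $i\in[n-1]$. Then \[ d_X(\emptyset;n)=A_H\bigl(\ell_0(n),\dots,\ell_{m-1}(n)\bigr)\cdot\prod_{r\in\mathbb{Z}/m\mathbb{Z}}\ell_r(n)!. \] Moreover, the multivariate generating function \[ F(x;y_0,\dots,y_{m-1})=\sum_{n\ge1}\sum_{\ell_0+\cdots+\ell_{m-1}=n}A_H(\ell_0,\dots,\ell_{m-1})\,x^n y_0^{\ell_0}\cdots y_{m-1}^{\ell_{m-1}} \] is a rational function.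
   Context: $[n]=\{1,\dots,n\}$. For $\pi=\pi_1\cdots\pi_n\in\mathfrak{S}_n$, $\mathrm{XDes}(\pi)=\{i\in[n-1]:(\pi_i,\pi_{i+1})\in X\}$, and $d_X(\emptyset;n)$ is the number of $\pi\in\mathfrak{S}_n$ with $\mathrm{XDes}(\pi)=\emptyset$. *)

theory Defs
  imports Complex_Main "HOL-Library.Poly_Mapping" "HOL-Number_Theory.Cong" "HOL-Combinatorics.Permutations"
begin

text \<open>
  Permutations of \<open>[n]\<close> are functions with \<open>\<pi> permutes {1..n}\<close>, and residue classes modulo \<open>m\<close>
  are represented by their least representatives \<open>{..<m}\<close>.
\<close>

definition XDes :: "(nat \<times> nat) set \<Rightarrow> nat \<Rightarrow> (nat \<Rightarrow> nat) \<Rightarrow> nat set" where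
  "XDes X n \<pi> = {i \<in> {1..n - 1}. (\<pi> i, \<pi> (i + 1)) \<in> X}"

definition d_X :: "(nat \<times> nat) set \<Rightarrow> nat set \<Rightarrow> nat \<Rightarrow> nat" where
  "d_X X I n = card {\<pi>. \<pi> permutes {1..n} \<and> XDes X n \<pi> = I}"

text \<open>
  Only positive integers are constrained; pairs in \<open>X\<close> with a zero component never influence
  \<open>XDes\<close>, so the convention chosen for \<open>0 \<in> \<nat>\<close> is immaterial.
\<close>

definition periodic_mod :: "nat \<Rightarrow> (nat \<times> nat) set \<Rightarrow> (nat \<Rightarrow> nat \<Rightarrow> nat) \<Rightarrow> bool" where
  "periodic_mod m X f \<longleftrightarrow>
     (\<forall>r<m. \<forall>s<m. f r s \<in> {0, 1}) \<and>
     (\<forall>a\<ge>1. \<forall>b\<ge>1. a \<noteq> b \<longrightarrow> ((a, b) \<in> X \<longleftrightarrow> f (a mod m) (b mod m) = 1))"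

definition residue_digraph :: "nat \<Rightarrow> (nat \<Rightarrow> nat \<Rightarrow> nat) \<Rightarrow> (nat \<times> nat) set" where
  "residue_digraph m f = {(r, s). r < m \<and> s < m \<and> f r s = 0}"

definition residue_count :: "nat \<Rightarrow> nat \<Rightarrow> nat \<Rightarrow> nat" where
  "residue_count m n r = card {t \<in> {1..n}. [t = r] (mod m)}"

definition A_H :: "nat \<Rightarrow> (nat \<times> nat) set \<Rightarrow> (nat \<Rightarrow> nat) \<Rightarrow> nat" where
  "A_H m H l = card {w. set w \<subseteq> {..<m} \<and> length w = (\<Sum>r<m. l r) \<and>
                        (\<forall>r<m. count_list w r = l r) \<and>
                        (\<forall>i. i + 1 < length w \<longrightarrow> (w ! i, w ! (i + 1)) \<in> H)}"

text \<open>
  A monomial in variables from \<open>'v\<close> is its exponent vector \<open>'v \<Rightarrow>\<^sub>0 nat\<close>, a polynomial is an element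
  of \<open>('v \<Rightarrow>\<^sub>0 nat) \<Rightarrow>\<^sub>0 'a\<close>, and a formal power series is an arbitrary coefficient function on
  monomials, multiplied by the Cauchy product.
\<close>

type_synonym ('v, 'a) mpower_series = "('v \<Rightarrow>\<^sub>0 nat) \<Rightarrow> 'a"

definition mps_times ::
  "('v, 'a::comm_semiring_0) mpower_series \<Rightarrow> ('v, 'a) mpower_series \<Rightarrow> ('v, 'a) mpower_series"
  where
  "mps_times F G = (\<lambda>\<mu>. \<Sum>(\<alpha>, \<beta>) | \<alpha> + \<beta> = \<mu>. F \<alpha> * G \<beta>)"

lemma finite_monomial_splittings: "finite {(\<alpha>, \<beta>). \<alpha> + \<beta> = (\<mu> :: 'v \<Rightarrow>\<^sub>0 nat)}"
proof -
  define K where "K = Poly_Mapping.keys \<mu>"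
  define N where "N = (\<Sum>v\<in>K. Poly_Mapping.lookup \<mu> v)"
  define S where "S = {g :: 'v \<Rightarrow> nat. \<forall>v. (v \<in> K \<longrightarrow> g v \<in> {..N}) \<and> (v \<notin> K \<longrightarrow> g v = 0)}"
  define T where "T = {\<alpha>. \<exists>\<beta>. \<alpha> + \<beta> = \<mu>}"
  have "finite K"
    by (simp add: K_def)
  then have "finite S"
    unfolding S_def by (intro finite_set_of_finite_funs) auto
  moreover have "Poly_Mapping.lookup ` T \<subseteq> S"
  proof clarify
    fix \<alpha> assume "\<alpha> \<in> T"
    then have le: "Poly_Mapping.lookup \<alpha> v \<le> Poly_Mapping.lookup \<mu> v" for v
      by (auto simp: T_def lookup_add)
    have "Poly_Mapping.lookup \<mu> v \<le> N" if "v \<in> K" for v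
      unfolding N_def using that \<open>finite K\<close> by (intro member_le_sum) auto
    moreover have "Poly_Mapping.lookup \<mu> v = 0" if "v \<notin> K" for v
      using that by (simp add: K_def in_keys_iff)
    ultimately show "Poly_Mapping.lookup \<alpha> \<in> S"
      using le by (simp add: S_def) (metis le_trans le_zero_eq)
  qed
  moreover have "inj_on Poly_Mapping.lookup T"
    by (auto intro!: inj_onI simp: poly_mapping.lookup_inject)
  ultimately have "finite T"
    by (meson finite_imageD finite_subset)
  moreover have "{(\<alpha>, \<beta>). \<alpha> + \<beta> = \<mu>} \<subseteq> (\<lambda>\<alpha>. (\<alpha>, \<mu> - \<alpha>)) ` T"
    by (auto simp: T_def)
  ultimately show ?thesis
    by (meson finite_imageI finite_subset)
qed

lemma mps_times_polynomials:
  fixes P Q :: "('v \<Rightarrow>\<^sub>0 nat) \<Rightarrow>\<^sub>0 'a::comm_semiring_0"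
  shows "mps_times (Poly_Mapping.lookup P) (Poly_Mapping.lookup Q) = Poly_Mapping.lookup (P * Q)"
proof
  fix \<mu> :: "'v \<Rightarrow>\<^sub>0 nat"
  have "Poly_Mapping.lookup (P * Q) \<mu> =
        (\<Sum>(\<alpha>, \<beta>). Poly_Mapping.lookup P \<alpha> * Poly_Mapping.lookup Q \<beta> when \<mu> = \<alpha> + \<beta>)"
    unfolding times_poly_mapping.rep_eq by (rule prod_fun_unfold_prod) simp_all
  also have "\<dots> = (\<Sum>p\<in>{(\<alpha>, \<beta>). \<alpha> + \<beta> = \<mu>}.
                  (case p of (\<alpha>, \<beta>) \<Rightarrow> Poly_Mapping.lookup P \<alpha> * Poly_Mapping.lookup Q \<beta> when \<mu> = \<alpha> + \<beta>))"
    by (rule Sum_any.expand_superset[OF finite_monomial_splittings]) (auto simp: when_def split: if_splits)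
  also have "\<dots> = mps_times (Poly_Mapping.lookup P) (Poly_Mapping.lookup Q) \<mu>"
    unfolding mps_times_def by (rule sum.cong) (auto simp: when_def)
  finally show "mps_times (Poly_Mapping.lookup P) (Poly_Mapping.lookup Q) \<mu> =
        Poly_Mapping.lookup (P * Q) \<mu>"
    by simp
qed

text \<open>
  A series in the variables \<open>V\<close> is a rational function if it is \<open>P / Q\<close> for polynomials \<open>P\<close>, \<open>Q\<close> in
  these variables, where \<open>Q\<close> is invertible as a power series, i.e. has non-zero constant term.
\<close>

definition poly_in :: "'v set \<Rightarrow> (('v \<Rightarrow>\<^sub>0 nat) \<Rightarrow>\<^sub>0 'a::zero) \<Rightarrow> bool" where
  "poly_in V P \<longleftrightarrow> (\<forall>\<mu>\<in>Poly_Mapping.keys P. Poly_Mapping.keys \<mu> \<subseteq> V)"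

definition rational_series :: "'v set \<Rightarrow> ('v, 'a::field) mpower_series \<Rightarrow> bool" where
  "rational_series V F \<longleftrightarrow>
     (\<exists>P Q :: ('v \<Rightarrow>\<^sub>0 nat) \<Rightarrow>\<^sub>0 'a. poly_in V P \<and> poly_in V Q \<and> Poly_Mapping.lookup Q 0 \<noteq> 0 \<and>
        mps_times (Poly_Mapping.lookup Q) F = Poly_Mapping.lookup P)"

datatype gf_var = Var_x | Var_y nat

definition gf_vars :: "nat \<Rightarrow> gf_var set" where
  "gf_vars m = insert Var_x (Var_y ` {..<m})"

text \<open>
  The coefficient of a monomial \<open>\<mu>\<close> in \<open>F(x; y\<^sub>0, \<dots>)\<close>: only the monomials
  \<open>x\<^sup>n y\<^sub>0\<^bsup>l 0\<^esup> \<cdots>\<close> with \<open>n \<ge> 1\<close> and \<open>n = \<Sum>r<m. l r\<close> occur, each exactly once.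
\<close>

definition F_H :: "nat \<Rightarrow> (nat \<times> nat) set \<Rightarrow> (gf_var, rat) mpower_series" where
  "F_H m H \<mu> =
     (if Poly_Mapping.keys \<mu> \<subseteq> gf_vars m \<and> Poly_Mapping.lookup \<mu> Var_x \<ge> 1 \<and>
         (\<Sum>r<m. Poly_Mapping.lookup \<mu> (Var_y r)) = Poly_Mapping.lookup \<mu> Var_x
      then of_nat (A_H m H (\<lambda>r. Poly_Mapping.lookup \<mu> (Var_y r))) else 0)"

end

theory Submission
  imports Defs "HOL-Library.Function_Algebras"
begin

text \<open>
  Reducing a permutation of \<open>[n]\<close> modulo \<open>m\<close> gives a word with \<open>residue_count m n r\<close> letters \<open>r\<close>.
  Consecutive entries are distinct, so the permutation has no \<open>X\<close>-descent iff this word is a walk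
  in \<open>H\<close>; and each word arises from \<open>\<Prod>r. \<ell>\<^sub>r(n)!\<close> permutations, since the entries of each residue
  class can be placed in any order on the positions of that letter.

  For rationality, let \<open>F\<^sub>s\<close> be the series of the walks starting at \<open>s\<close>. Splitting off the first letter
  gives \<open>F\<^sub>s = x y\<^sub>s (1 + \<Sum>t. F\<^sub>t)\<close>, summed over the edges \<open>s \<rightarrow> t\<close>: a linear system over the polynomial
  ring whose matrix is the identity up to terms without constant coefficient, which Gaussian
  elimination solves without dividing by a non-unit.
\<close>

section \<open>Arrangements with a prescribed word of colours\<close>

lemma count_list_map_distinct:
  assumes "distinct xs"
  shows "count_list (map c xs) r = card {b \<in> set xs. c b = r}"
proof -
  have "count_list (map c xs) r = length (filter (\<lambda>x. c x = r) xs)"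
    by (induction xs) auto
  also have "\<dots> = card {b \<in> set xs. c b = r}"
    using assms by (metis distinct_card distinct_filter set_filter)
  finally show ?thesis .
qed

text \<open>Induction on the word: its first letter \<open>a\<close> can be realised by any of the
  \<open>k\<close> elements of \<open>B\<close> of colour \<open>a\<close>. Removing the chosen
  element lowers this class to \<open>k - 1\<close> and leaves the other classes alone, so the
  factor for \<open>a\<close> becomes \<open>k * fact (k - 1) = fact k\<close>.\<close>

lemma card_arrangements_with_colour_word:
  fixes c :: "'a \<Rightarrow> 'c"
  assumes "finite B" "finite C" "c ` B \<subseteq> C" "set w \<subseteq> C"
    and "\<And>r. r \<in> C \<Longrightarrow> count_list w r = card {b \<in> B. c b = r}"
  shows "card {xs. distinct xs \<and> set xs = B \<and> map c xs = w}
           = (\<Prod>r\<in>C. fact (card {b \<in> B. c b = r}))"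
  using assms(1,3-5)
proof (induction w arbitrary: B)
  case Nil
  have "B = {}"
  proof (rule ccontr)
    assume "B \<noteq> {}"
    then obtain b where "b \<in> B" by blast
    then have "{b' \<in> B. c b' = c b} = {}"
      using Nil.prems(4)[of "c b"] Nil.prems(1,2) by auto
    with \<open>b \<in> B\<close> show False by blast
  qed
  then have "{xs. distinct xs \<and> set xs = B \<and> map c xs = []} = {[]}" by auto
  with \<open>B = {}\<close> show ?case by simp
next
  case (Cons a w)
  define k where "k B r = card {b \<in> B. c b = r}" for B r
  define L where "L B w = {xs. distinct xs \<and> set xs = B \<and> map c xs = w}" for B w
  define Ba where "Ba = {b \<in> B. c b = a}"
  have "a \<in> C" using Cons.prems by simp
  have "finite Ba" using Cons.prems by (simp add: Ba_def)
  have k_a: "k B a = Suc (count_list w a)"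
    using Cons.prems(4)[OF \<open>a \<in> C\<close>] by (simp add: k_def)
  have remove: "k (B - {b}) r = (if r = a then k B a - 1 else k B r)" if "b \<in> Ba" for b r
  proof (cases "r = a")
    case True
    have "{b' \<in> B - {b}. c b' = a} = Ba - {b}" by (auto simp: Ba_def)
    with that True show ?thesis by (simp add: k_def Ba_def)
  next
    case False
    then have "{b' \<in> B - {b}. c b' = r} = {b' \<in> B. c b' = r}" using that by (auto simp: Ba_def)
    with False show ?thesis by (simp add: k_def)
  qed
  have IH: "card (L (B - {b}) w) = fact (k B a - 1) * (\<Prod>r\<in>C - {a}. fact (k B r))"
    if "b \<in> Ba" for b
  proof -
    have "card (L (B - {b}) w) = (\<Prod>r\<in>C. fact (k (B - {b}) r))"
      unfolding L_def k_def
    proof (rule Cons.IH)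
      fix r assume "r \<in> C"
      with Cons.prems(4)[OF this] remove[OF that, of r]
      show "count_list w r = card {b' \<in> B - {b}. c b' = r}"
        by (auto simp: k_def split: if_splits)
    qed (use Cons.prems in auto)
    also have "\<dots> = (\<Prod>r\<in>C. fact (if r = a then k B a - 1 else k B r))"
      using remove[OF that] by simp
    also have "\<dots> = fact (k B a - 1) * (\<Prod>r\<in>C - {a}. fact (k B r))"
      using \<open>finite C\<close> \<open>a \<in> C\<close> by (simp add: prod.remove)
    finally show ?thesis .
  qed
  have finL: "finite (L B' w)" if "finite B'" for B'
    unfolding L_def using finite_subset_distinct[OF that]
    by (rule finite_subset[rotated]) auto
  have "L B (a # w) = (\<Union>b\<in>Ba. Cons b ` L (B - {b}) w)"
  proof (intro set_eqI)
    fix xs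
    show "xs \<in> L B (a # w) \<longleftrightarrow> xs \<in> (\<Union>b\<in>Ba. Cons b ` L (B - {b}) w)"
    proof (cases xs)
      case (Cons x ys)
      have "x # ys \<in> (\<Union>b\<in>Ba. Cons b ` L (B - {b}) w) \<longleftrightarrow> x \<in> Ba \<and> ys \<in> L (B - {x}) w" by blast
      then show ?thesis unfolding Cons by (auto simp: L_def Ba_def)
    qed (auto simp: L_def)
  qed
  then have "card (L B (a # w)) = (\<Sum>b\<in>Ba. card (Cons b ` L (B - {b}) w))"
    using \<open>finite Ba\<close> finL Cons.prems(1) by (subst card_UN_disjoint[symmetric]) auto
  also have "\<dots> = (\<Sum>b\<in>Ba. card (L (B - {b}) w))"
    by (simp add: card_image)
  also have "\<dots> = k B a * (fact (k B a - 1) * (\<Prod>r\<in>C - {a}. fact (k B r)))"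
    using IH by (simp add: k_def Ba_def)
  also have "\<dots> = (\<Prod>r\<in>C. fact (k B r))"
    using \<open>finite C\<close> \<open>a \<in> C\<close> k_a by (simp add: prod.remove algebra_simps)
  finally show ?case by (simp add: L_def k_def)
qed

section \<open>Permutations without descents and words of residues\<close>

lemma bij_betw_permutes_lists:
  "bij_betw (\<lambda>\<pi>. map \<pi> [1..<Suc n]) {\<pi>. \<pi> permutes {1..n}} {xs. distinct xs \<and> set xs = {1..n}}"
proof (rule bij_betwI')
  fix \<pi> \<sigma> assume "\<pi> \<in> {\<pi>. \<pi> permutes {1..n}}" "\<sigma> \<in> {\<pi>. \<pi> permutes {1..n}}"
  then have *: "\<pi> permutes {1..n}" "\<sigma> permutes {1..n}" by auto
  show "map \<pi> [1..<Suc n] = map \<sigma> [1..<Suc n] \<longleftrightarrow> \<pi> = \<sigma>"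
  proof
    assume "map \<pi> [1..<Suc n] = map \<sigma> [1..<Suc n]"
    then have "\<pi> i = \<sigma> i" if "i \<in> {1..n}" for i
      using that by (auto simp del: upt_Suc)
    with * show "\<pi> = \<sigma>" by (metis ext permutes_not_in)
  qed simp
next
  fix \<pi> assume "\<pi> \<in> {\<pi>. \<pi> permutes {1..n}}"
  then have "\<pi> permutes {1..n}" by simp
  then show "map \<pi> [1..<Suc n] \<in> {xs. distinct xs \<and> set xs = {1..n}}"
    using permutes_image[of \<pi> "{1..n}"] permutes_inj_on[of \<pi> "{1..n}"]
    by (simp add: distinct_map atLeastLessThanSuc_atLeastAtMost del: upt_Suc)
next
  fix xs assume "xs \<in> {xs. distinct xs \<and> set xs = {1..n}}"
  then have xs: "distinct xs" "set xs = {1..n}" by auto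
  then have len: "length xs = n" using distinct_card[of xs] by simp
  \<comment> \<open>List positions start at 0 and arguments of permutations at 1, hence the shift;
    \<open>permutes\<close> demands the identity outside \<open>{1..n}\<close>.\<close>
  define \<pi> where "\<pi> i = (if i \<in> {1..n} then xs ! (i - 1) else i)" for i
  have map_eq: "map \<pi> [1..<Suc n] = xs"
    by (rule nth_equalityI) (auto simp: len \<pi>_def nth_append simp del: upt_Suc)
  have "set [1..<Suc n] = {1..n}" by auto
  then have "bij_betw \<pi> {1..n} {1..n}"
    using xs map_eq by (metis bij_betw_def distinct_map image_set)
  then have "\<pi> permutes {1..n}"
    by (rule bij_imp_permutes) (auto simp: \<pi>_def)
  with map_eq show "\<exists>\<pi>\<in>{\<pi>. \<pi> permutes {1..n}}. xs = map \<pi> [1..<Suc n]" by auto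
qed

lemma d_X_empty_eq:
  assumes "m \<ge> 1" and per: "periodic_mod m X f"
  shows "d_X X {} n = A_H m (residue_digraph m f) (residue_count m n) *
           (\<Prod>r<m. fact (residue_count m n r))"
proof -
  define H where "H = residue_digraph m f"
  define c where "c t = t mod m" for t
  define L where "L = {xs. distinct xs \<and> set xs = {1..n}}"
  define W where "W = {w. set w \<subseteq> {..<m} \<and> length w = (\<Sum>r<m. residue_count m n r) \<and>
                        (\<forall>r<m. count_list w r = residue_count m n r) \<and>
                        (\<forall>i. i + 1 < length w \<longrightarrow> (w ! i, w ! (i + 1)) \<in> H)}"
  have c_less: "c t < m" for t using \<open>m \<ge> 1\<close> by (simp add: c_def)
  have rc: "residue_count m n r = card {b \<in> {1..n}. c b = r}" if "r < m" for r
    using that by (simp add: residue_count_def c_def cong_def)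
  have H_iff: "(c a, c b) \<in> H \<longleftrightarrow> (a, b) \<notin> X" if "a \<ge> 1" "b \<ge> 1" "a \<noteq> b" for a b
  proof -
    have "f (c a) (c b) = 0 \<or> f (c a) (c b) = 1" using per c_less by (auto simp: periodic_mod_def)
    moreover have "(a, b) \<in> X \<longleftrightarrow> f (c a) (c b) = 1"
      using per that by (simp add: periodic_mod_def c_def)
    ultimately show ?thesis using c_less by (auto simp: H_def residue_digraph_def)
  qed
  \<comment> \<open>A list of all of \<open>[n]\<close> has the prescribed letter counts and length
    automatically, so only the adjacency condition of \<open>W\<close> remains.\<close>
  have word: "map c xs \<in> W \<longleftrightarrow> (\<forall>i. i + 1 < length xs \<longrightarrow> (c (xs ! i), c (xs ! (i + 1))) \<in> H)"
    if "xs \<in> L" for xs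
  proof -
    have counts: "count_list (map c xs) r = residue_count m n r" if "r < m" for r
      using \<open>xs \<in> L\<close> rc[OF that] by (simp add: L_def count_list_map_distinct)
    have "set (map c xs) \<subseteq> {..<m}" using c_less by auto
    moreover from this have "length (map c xs) = (\<Sum>r<m. residue_count m n r)"
      using counts sum_count_set[of "map c xs" "{..<m}"] by simp
    ultimately show ?thesis using counts by (auto simp: W_def)
  qed
  have des: "XDes X n \<pi> = {} \<longleftrightarrow> map c (map \<pi> [1..<Suc n]) \<in> W" if \<pi>: "\<pi> permutes {1..n}" for \<pi>
  proof -
    define xs where "xs = map \<pi> [1..<Suc n]"
    have "xs \<in> L" using bij_betw_apply[OF bij_betw_permutes_lists[of n], of \<pi>] \<pi>
      by (simp add: L_def xs_def del: upt_Suc)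
    have nth: "xs ! i = \<pi> (i + 1)" if "i < n" for i
      using that by (simp add: xs_def del: upt_Suc)
    \<comment> \<open>Periodicity says something about distinct positive integers only: injectivity
      gives distinctness, and \<pi> maps \<open>{1..n}\<close> to itself.\<close>
    have edge: "(c (\<pi> i), c (\<pi> (i + 1))) \<in> H \<longleftrightarrow> (\<pi> i, \<pi> (i + 1)) \<notin> X" if "1 \<le> i" "i + 1 \<le> n" for i
    proof (rule H_iff)
      show "\<pi> i \<noteq> \<pi> (i + 1)" using permutes_inj[OF \<pi>] by (metis injD Suc_eq_plus1 n_not_Suc_n)
      show "\<pi> i \<ge> 1" "\<pi> (i + 1) \<ge> 1"
        using permutes_in_image[OF \<pi>, of i] permutes_in_image[OF \<pi>, of "i + 1"] that by auto
    qed
    have "map c xs \<in> W \<longleftrightarrow> (\<forall>i. i + 1 < n \<longrightarrow> (c (\<pi> (i + 1)), c (\<pi> (i + 1 + 1))) \<in> H)"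
      using word[OF \<open>xs \<in> L\<close>] nth by (simp add: xs_def del: upt_Suc)
    also have "\<dots> \<longleftrightarrow> (\<forall>i. i + 1 < n \<longrightarrow> (\<pi> (i + 1), \<pi> (i + 1 + 1)) \<notin> X)"
      using edge by (metis Suc_eq_plus1 Suc_leI le_add2)
    also have "\<dots> \<longleftrightarrow> (\<forall>i\<in>{1..n - 1}. (\<pi> i, \<pi> (i + 1)) \<notin> X)"
    proof
      assume *: "\<forall>i. i + 1 < n \<longrightarrow> (\<pi> (i + 1), \<pi> (i + 1 + 1)) \<notin> X"
      show "\<forall>i\<in>{1..n - 1}. (\<pi> i, \<pi> (i + 1)) \<notin> X"
      proof
        fix i assume "i \<in> {1..n - 1}"
        then have "i - 1 + 1 < n" "i - 1 + 1 = i" by auto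
        with *[rule_format, of "i - 1"] show "(\<pi> i, \<pi> (i + 1)) \<notin> X" by metis
      qed
    qed auto
    also have "\<dots> \<longleftrightarrow> XDes X n \<pi> = {}" by (auto simp: XDes_def)
    finally show ?thesis by (simp add: xs_def)
  qed
  have "bij_betw (\<lambda>\<pi>. map \<pi> [1..<Suc n]) {\<pi> \<in> {\<pi>. \<pi> permutes {1..n}}. XDes X n \<pi> = {}}
          {xs \<in> L. map c xs \<in> W}"
    unfolding L_def using des by (intro bij_betw_Collect[OF bij_betw_permutes_lists]) blast
  then have "d_X X {} n = card {xs \<in> L. map c xs \<in> W}"
    unfolding d_X_def by (simp add: bij_betw_same_card del: upt_Suc)
  \<comment> \<open>The lists are grouped by their residue word. All these fibres have the same
    size, so the sum over \<open>W\<close> becomes a product.\<close>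
  also have "{xs \<in> L. map c xs \<in> W} = (\<Union>w\<in>W. {xs. distinct xs \<and> set xs = {1..n} \<and> map c xs = w})"
    by (auto simp: L_def)
  also have "card \<dots> = (\<Sum>w\<in>W. card {xs. distinct xs \<and> set xs = {1..n} \<and> map c xs = w})"
  proof (rule card_UN_disjoint)
    show "finite W"
      by (rule finite_subset[OF _ finite_lists_length_eq[of "{..<m}" "\<Sum>r<m. residue_count m n r"]])
         (auto simp: W_def)
    show "\<forall>w\<in>W. finite {xs. distinct xs \<and> set xs = {1..n} \<and> map c xs = w}"
      by (auto intro: finite_subset[OF _ finite_subset_distinct[of "{1..n}"]])
  qed auto
  also have "\<dots> = (\<Sum>w\<in>W. \<Prod>r<m. fact (card {b \<in> {1..n}. c b = r}))"
    using c_less rc by (intro sum.cong card_arrangements_with_colour_word refl) (auto simp: W_def)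
  also have "\<dots> = card W * (\<Prod>r<m. fact (residue_count m n r))"
    using rc by simp
  finally show ?thesis by (simp add: A_H_def W_def H_def)
qed

section \<open>Power series as a module over polynomials\<close>

text \<open>Both sides are sums over all ways to write \<mu> as a sum of three monomials; the
  reindexing moves the bracket from the last two summands to the first two.\<close>

lemma mps_times_assoc:
  "mps_times F (mps_times G K) = mps_times (mps_times F G) K"
proof
  fix \<mu> :: "'a \<Rightarrow>\<^sub>0 nat"
  let ?S = "\<lambda>\<mu> :: 'a \<Rightarrow>\<^sub>0 nat. {(\<alpha>, \<beta>). \<alpha> + \<beta> = \<mu>}"
  have "mps_times F (mps_times G K) \<mu>
      = (\<Sum>p\<in>?S \<mu>. \<Sum>q\<in>?S (snd p). F (fst p) * (G (fst q) * K (snd q)))"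
    by (simp add: mps_times_def case_prod_unfold sum_distrib_left)
  also have "\<dots> = (\<Sum>(p, q)\<in>Sigma (?S \<mu>) (\<lambda>p. ?S (snd p)). F (fst p) * (G (fst q) * K (snd q)))"
    by (rule sum.Sigma) (auto simp: finite_monomial_splittings)
  also have "\<dots> = (\<Sum>(p, q)\<in>Sigma (?S \<mu>) (\<lambda>p. ?S (fst p)). F (fst q) * G (snd q) * K (snd p))"
    by (rule sum.reindex_bij_witness[where
          i = "\<lambda>((a, b), (c, d)). ((c, d + b), (d, b))" and
          j = "\<lambda>((a, b), (c, d)). ((a + c, d), (a, c))"]) (auto simp: ac_simps)
  also have "\<dots> = (\<Sum>p\<in>?S \<mu>. \<Sum>q\<in>?S (fst p). F (fst q) * G (snd q) * K (snd p))"
    by (rule sum.Sigma[symmetric]) (auto simp: finite_monomial_splittings)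
  also have "\<dots> = mps_times (mps_times F G) K \<mu>"
    by (simp add: mps_times_def case_prod_unfold sum_distrib_right)
  finally show "mps_times F (mps_times G K) \<mu> = mps_times (mps_times F G) K \<mu>" .
qed

text \<open>The Cauchy product with its left factor typed as a polynomial. Polynomials thus become
  the scalars of a module of series under pointwise addition, and the \<open>module\<close> locale
  supplies the linear algebra.\<close>

definition poly_scale ::
  "(('v \<Rightarrow>\<^sub>0 nat) \<Rightarrow>\<^sub>0 'a::comm_ring_1) \<Rightarrow> ('v, 'a) mpower_series \<Rightarrow> ('v, 'a) mpower_series"
  where "poly_scale P F = mps_times (Poly_Mapping.lookup P) F"

text \<open>Exponent vectors cancel, so \<open>(e, \<beta>)\<close> is the only splitting whose
  first part is \<open>e\<close>. The case \<open>e = 0\<close> gives the unit law of the module;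
  letter monomials give the effect of prefixing a letter.\<close>

lemma poly_scale_single:
  "poly_scale (Poly_Mapping.single e a) F (e + \<beta>) = a * F \<beta>"
proof -
  have "poly_scale (Poly_Mapping.single e a) F (e + \<beta>)
      = (\<Sum>p\<in>{(e, \<beta>)}. case p of (\<gamma>, \<delta>) \<Rightarrow> Poly_Mapping.lookup (Poly_Mapping.single e a) \<gamma> * F \<delta>)"
    unfolding poly_scale_def mps_times_def
    by (rule sum.mono_neutral_right[OF finite_monomial_splittings])
       (auto simp: lookup_single when_def split: if_splits)
  then show ?thesis by simp
qed

lemma poly_scale_single_eq_0:
  assumes "\<nexists>\<beta>. \<mu> = e + \<beta>"
  shows "poly_scale (Poly_Mapping.single e a) F \<mu> = 0"
  unfolding poly_scale_def mps_times_def
  by (rule sum.neutral) (use assms in \<open>auto simp: lookup_single when_def\<close>)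

interpretation mps: module
  "poly_scale :: (('v \<Rightarrow>\<^sub>0 nat) \<Rightarrow>\<^sub>0 'a::comm_ring_1) \<Rightarrow> ('v, 'a) mpower_series \<Rightarrow> ('v, 'a) mpower_series"
proof
  fix P Q :: "('v \<Rightarrow>\<^sub>0 nat) \<Rightarrow>\<^sub>0 'a::comm_ring_1" and F G :: "('v, 'a) mpower_series"
  show "poly_scale P (F + G) = poly_scale P F + poly_scale P G"
    by (rule ext)
       (simp add: poly_scale_def mps_times_def case_prod_unfold distrib_left sum.distrib)
  show "poly_scale (P + Q) F = poly_scale P F + poly_scale Q F"
    by (rule ext)
       (simp add: poly_scale_def mps_times_def case_prod_unfold distrib_right lookup_add sum.distrib)
  show "poly_scale P (poly_scale Q F) = poly_scale (P * Q) F"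
    by (simp add: poly_scale_def mps_times_assoc mps_times_polynomials)
  show "poly_scale 1 F = F"
    using poly_scale_single[of 0 1 F] by (auto simp: fun_eq_iff)
qed

lemma poly_scale_lookup: "poly_scale P (Poly_Mapping.lookup Q) = Poly_Mapping.lookup (P * Q)"
  by (simp add: poly_scale_def mps_times_polynomials)

section \<open>Constant terms and variables of polynomials\<close>

lemma lookup_diff_fun:
  "Poly_Mapping.lookup (P - Q) = Poly_Mapping.lookup P - Poly_Mapping.lookup Q"
  by (simp add: fun_eq_iff lookup_minus)

text \<open>Natural exponents add up to 0 only if all of them are 0, so only the trivial splitting
  contributes. Constant terms can therefore be followed through the elimination.\<close>

lemma lookup_times_0:
  fixes P Q :: "('v \<Rightarrow>\<^sub>0 nat) \<Rightarrow>\<^sub>0 'a::comm_semiring_0"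
  shows "Poly_Mapping.lookup (P * Q) 0 = Poly_Mapping.lookup P 0 * Poly_Mapping.lookup Q 0"
proof -
  have zero: "\<alpha> = 0 \<and> \<beta> = 0" if "\<alpha> + \<beta> = 0" for \<alpha> \<beta> :: "'v \<Rightarrow>\<^sub>0 nat"
    using that by (metis add_eq_0_iff_both_eq_0 lookup_add lookup_zero poly_mapping_eqI)
  have "{(\<alpha>, \<beta>). \<alpha> + \<beta> = (0 :: 'v \<Rightarrow>\<^sub>0 nat)} = {(0, 0)}" by (auto dest: zero)
  then show ?thesis by (simp add: mps_times_polynomials[symmetric] mps_times_def)
qed

lemma poly_in_diff: "poly_in V P \<Longrightarrow> poly_in V Q \<Longrightarrow> poly_in V (P - Q :: _ \<Rightarrow>\<^sub>0 'a::ab_group_add)"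
  using keys_diff[of P Q] unfolding poly_in_def by blast

lemma poly_in_uminus: "poly_in V P \<Longrightarrow> poly_in V (- P :: _ \<Rightarrow>\<^sub>0 'a::ab_group_add)"
  by (simp add: poly_in_def in_keys_iff)

lemma poly_in_times:
  assumes "poly_in V P" "poly_in V Q"
  shows "poly_in V (P * Q :: ('v \<Rightarrow>\<^sub>0 nat) \<Rightarrow>\<^sub>0 'a::semiring_0)"
  unfolding poly_in_def
proof
  fix \<mu> assume "\<mu> \<in> Poly_Mapping.keys (P * Q)"
  then obtain \<alpha> \<beta> where "\<mu> = \<alpha> + \<beta>" "\<alpha> \<in> Poly_Mapping.keys P" "\<beta> \<in> Poly_Mapping.keys Q"
    using keys_mult[of P Q] by blast
  with assms show "Poly_Mapping.keys \<mu> \<subseteq> V"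
    using keys_add[of \<alpha> \<beta>] unfolding poly_in_def by blast
qed

section \<open>Gaussian elimination\<close>

text \<open>
  Cross-multiplied elimination of an unknown \<open>u\<close> replaces \<open>N s t\<close> by
  \<open>N u u * N s t - N s u * N u t\<close>. The constant terms of the rows in \<open>S\<close> form an invertible diagonal
  matrix, and this property survives the elimination.
\<close>

lemma rational_series_linear_system:
  fixes N :: "'i \<Rightarrow> 'i \<Rightarrow> ('v \<Rightarrow>\<^sub>0 nat) \<Rightarrow>\<^sub>0 'a::field"
  assumes "finite S" "z \<notin> S"
    and "\<And>s t. s \<in> insert z S \<Longrightarrow> t \<in> insert z S \<Longrightarrow> poly_in V (N s t)"
    and "\<And>s. s \<in> insert z S \<Longrightarrow> poly_in V (b s)"
    and "\<And>s. s \<in> insert z S \<Longrightarrow> Poly_Mapping.lookup (N s s) 0 \<noteq> 0"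
    and "\<And>s t. s \<in> S \<Longrightarrow> t \<in> insert z S \<Longrightarrow> s \<noteq> t \<Longrightarrow> Poly_Mapping.lookup (N s t) 0 = 0"
    and "\<And>s. s \<in> insert z S \<Longrightarrow>
           (\<Sum>t\<in>insert z S. poly_scale (N s t) (F t)) = Poly_Mapping.lookup (b s)"
  shows "rational_series V (F z)"
  using assms
proof (induction S arbitrary: N b rule: finite_induct)
  case empty
  \<comment> \<open>The single remaining equation exhibits \<open>F z\<close> as
    \<open>b z / N z z\<close>, with an invertible denominator.\<close>
  then have "poly_scale (N z z) (F z) = Poly_Mapping.lookup (b z)" by simp
  moreover have "poly_in V (N z z)" "poly_in V (b z)" "Poly_Mapping.lookup (N z z) 0 \<noteq> 0"
    using empty.prems by auto
  ultimately show ?case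
    unfolding rational_series_def poly_scale_def by blast
next
  case (insert u S)
  let ?T = "insert z S"
  note polyN = insert.prems(2) and polyb = insert.prems(3) and diag = insert.prems(4)
    and offdiag = insert.prems(5) and eqs = insert.prems(6)
  define N' where "N' s t = N u u * N s t - N s u * N u t" for s t
  define b' where "b' s = N u u * b s - N s u * b u" for s
  have u: "u \<notin> ?T" "finite ?T" using insert by auto
  have eq: "(\<Sum>t\<in>?T. poly_scale (N s t) (F t)) = Poly_Mapping.lookup (b s) - poly_scale (N s u) (F u)"
    if "s \<in> insert u ?T" for s
  proof -
    have "(\<Sum>t\<in>insert u ?T. poly_scale (N s t) (F t)) = Poly_Mapping.lookup (b s)"
      using eqs[of s] that by (simp add: insert_commute)
    then show ?thesis using u by (simp add: algebra_simps)
  qed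
  show ?case
  proof (rule insert.IH[of N' b'])
    show "z \<notin> S" using insert.prems by simp
    show "poly_in V (N' s t)" if "s \<in> ?T" "t \<in> ?T" for s t
      unfolding N'_def using that by (intro poly_in_diff poly_in_times polyN) auto
    show "poly_in V (b' s)" if "s \<in> ?T" for s
      unfolding b'_def using that by (intro poly_in_diff poly_in_times polyN polyb) auto
    show "Poly_Mapping.lookup (N' s s) 0 \<noteq> 0" if "s \<in> ?T" for s
    proof -
      \<comment> \<open>The row of \<open>u\<close> is diagonal at constant terms, so
        \<open>N s u * N u s\<close> has constant term 0. This covers \<open>s = z\<close> as well,
        where \<open>N z u\<close> may have a non-zero constant term. What is left is the product of
        two diagonal constants.\<close>
      have "Poly_Mapping.lookup (N u s) 0 = 0"
        using that u by (intro offdiag) auto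
      then show ?thesis
        using that diag[of u] diag[of s] by (auto simp: N'_def lookup_minus lookup_times_0)
    qed
    show "Poly_Mapping.lookup (N' s t) 0 = 0" if "s \<in> S" "t \<in> ?T" "s \<noteq> t" for s t
    proof -
      have "Poly_Mapping.lookup (N s t) 0 = 0" "Poly_Mapping.lookup (N s u) 0 = 0"
        using that u by (auto intro!: offdiag)
      then show ?thesis by (simp add: N'_def lookup_minus lookup_times_0)
    qed
    show "(\<Sum>t\<in>?T. poly_scale (N' s t) (F t)) = Poly_Mapping.lookup (b' s)" if "s \<in> ?T" for s
    proof -
      have "(\<Sum>t\<in>?T. poly_scale (N' s t) (F t))
          = poly_scale (N u u) (\<Sum>t\<in>?T. poly_scale (N s t) (F t))
            - poly_scale (N s u) (\<Sum>t\<in>?T. poly_scale (N u t) (F t))"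
        unfolding N'_def mps.scale_left_diff_distrib sum_subtractf mps.scale_sum_right by simp
      also have "\<dots> = poly_scale (N u u) (Poly_Mapping.lookup (b s) - poly_scale (N s u) (F u))
            - poly_scale (N s u) (Poly_Mapping.lookup (b u) - poly_scale (N u u) (F u))"
        using eq[of s] eq[of u] that by simp
      \<comment> \<open>Both occurrences of \<open>F u\<close> carry the coefficient
        \<open>N u u * N s u\<close> and cancel.\<close>
      also have "\<dots> = Poly_Mapping.lookup (b' s)"
        by (simp add: b'_def mps.scale_right_diff_distrib poly_scale_lookup lookup_diff_fun mult.commute)
      finally show ?thesis .
    qed
  qed
qed

section \<open>The series of a language\<close>

definition letter_monomial :: "nat \<Rightarrow> gf_var \<Rightarrow>\<^sub>0 nat" where
  "letter_monomial r = Poly_Mapping.single Var_x 1 + Poly_Mapping.single (Var_y r) 1"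

definition word_monomial :: "nat list \<Rightarrow> gf_var \<Rightarrow>\<^sub>0 nat" where
  "word_monomial w = sum_list (map letter_monomial w)"

text \<open>The series translates operations on languages into algebra: disjoint union becomes
  addition, and prefixing a letter becomes multiplication by its monomial.\<close>

definition language_series :: "nat list set \<Rightarrow> (gf_var, rat) mpower_series" where
  "language_series L \<mu> = of_nat (card {w \<in> L. word_monomial w = \<mu>})"

lemma word_monomial_Cons: "word_monomial (a # w) = letter_monomial a + word_monomial w"
  by (simp add: word_monomial_def)

lemma lookup_word_monomial:
  "Poly_Mapping.lookup (word_monomial w) v =
     (case v of Var_x \<Rightarrow> length w | Var_y r \<Rightarrow> count_list w r)"
  by (induction w)
     (auto simp: word_monomial_def letter_monomial_def lookup_add lookup_single when_def split: gf_var.split)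

text \<open>The exponent of \<open>Var_x\<close> fixes the length, and the alphabet is finite. Hence
  the cardinalities in \<open>language_series\<close> are those of finite sets and add up over
  disjoint unions.\<close>

lemma finite_words_of_monomial:
  assumes "L \<subseteq> lists {..<m}"
  shows "finite {w \<in> L. word_monomial w = \<mu>}"
proof (rule finite_subset)
  show "{w \<in> L. word_monomial w = \<mu>}
      \<subseteq> {w. set w \<subseteq> {..<m} \<and> length w = Poly_Mapping.lookup \<mu> Var_x}"
    using assms lookup_word_monomial[of _ Var_x] by auto
qed (simp add: finite_lists_length_eq)

lemma language_series_Un:
  assumes "L \<subseteq> lists {..<m}" "K \<subseteq> lists {..<m}" "L \<inter> K = {}"
  shows "language_series (L \<union> K) = language_series L + language_series K"
proof
  fix \<mu>
  have "{w \<in> L \<union> K. word_monomial w = \<mu>}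
      = {w \<in> L. word_monomial w = \<mu>} \<union> {w \<in> K. word_monomial w = \<mu>}" by auto
  then show "language_series (L \<union> K) \<mu> = (language_series L + language_series K) \<mu>"
    using assms finite_words_of_monomial[OF assms(1), of \<mu>] finite_words_of_monomial[OF assms(2), of \<mu>]
    by (simp add: language_series_def) (subst card_Un_disjoint; auto)
qed

lemma language_series_UN:
  assumes "finite I" "\<And>i. i \<in> I \<Longrightarrow> L i \<subseteq> lists {..<m}"
    and "\<And>i j. i \<in> I \<Longrightarrow> j \<in> I \<Longrightarrow> i \<noteq> j \<Longrightarrow> L i \<inter> L j = {}"
  shows "language_series (\<Union>i\<in>I. L i) = (\<Sum>i\<in>I. language_series (L i))"
  using assms
proof (induction I rule: finite_induct)
  case empty
  show ?case by (simp add: language_series_def fun_eq_iff)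
next
  case (insert i I)
  have "language_series (L i \<union> (\<Union>j\<in>I. L j)) = language_series (L i) + language_series (\<Union>j\<in>I. L j)"
  proof (rule language_series_Un)
    show "L i \<inter> (\<Union>j\<in>I. L j) = {}" using insert.prems(2)[of i] insert.hyps by fastforce
  qed (use insert.prems(1) in blast)+
  with insert show ?case by simp
qed

lemma language_series_Nil: "language_series {[]} = Poly_Mapping.lookup 1"
proof
  fix \<mu>
  have "{w \<in> {[]}. word_monomial w = \<mu>} = (if \<mu> = 0 then {[]} else {})"
    by (auto simp: word_monomial_def)
  then show "language_series {[]} \<mu> = Poly_Mapping.lookup 1 \<mu>"
    by (simp add: language_series_def lookup_one when_def)
qed

text \<open>Cancelling the monomial of \<open>a\<close> matches the words of weight \<mu> on the
  left with the words of \<open>L\<close> of the quotient weight. If that monomial does not divide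
  \<mu>, both coefficients vanish.\<close>

lemma language_series_Cons:
  "language_series (Cons a ` L)
     = poly_scale (Poly_Mapping.single (letter_monomial a) 1) (language_series L)"
proof
  fix \<mu>
  show "language_series (Cons a ` L) \<mu>
     = poly_scale (Poly_Mapping.single (letter_monomial a) 1) (language_series L) \<mu>"
  proof (cases "\<exists>\<beta>. \<mu> = letter_monomial a + \<beta>")
    case True
    then obtain \<beta> where \<mu>: "\<mu> = letter_monomial a + \<beta>" by blast
    have "{w \<in> Cons a ` L. word_monomial w = \<mu>} = Cons a ` {w \<in> L. word_monomial w = \<beta>}"
      by (auto simp: \<mu> word_monomial_Cons)
    then show ?thesis
      by (simp add: \<mu> poly_scale_single language_series_def card_image)
  next
    case False
    then have "{w \<in> Cons a ` L. word_monomial w = \<mu>} = {}"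
      by (auto simp: word_monomial_Cons)
    then have "language_series (Cons a ` L) \<mu> = 0"
      by (simp only: language_series_def card.empty of_nat_0)
    with False show ?thesis by (simp add: poly_scale_single_eq_0)
  qed
qed

section \<open>Walks in the digraph and their linear system\<close>

definition walks :: "nat \<Rightarrow> (nat \<times> nat) set \<Rightarrow> nat list set" where
  "walks m H = {w \<in> lists {..<m}. w \<noteq> [] \<and> successively (\<lambda>r s. (r, s) \<in> H) w}"

text \<open>The weight of a word records its length and all its letter counts. The side condition in
  \<open>F_H\<close> describes exactly the weights that non-empty words over \<open>{..<m}\<close>
  can have; excluding the empty word corresponds to \<open>n \<ge> 1\<close>.\<close>

lemma F_H_eq_language_series: "F_H m H = language_series (walks m H)"
proof
  fix \<mu> :: "gf_var \<Rightarrow>\<^sub>0 nat"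
  let ?l = "Poly_Mapping.lookup \<mu>"
  let ?A = "{w. set w \<subseteq> {..<m} \<and> length w = (\<Sum>r<m. ?l (Var_y r)) \<and>
                (\<forall>r<m. count_list w r = ?l (Var_y r)) \<and>
                (\<forall>i. i + 1 < length w \<longrightarrow> (w ! i, w ! (i + 1)) \<in> H)}"
  let ?cond = "Poly_Mapping.keys \<mu> \<subseteq> gf_vars m \<and> ?l Var_x \<ge> 1 \<and> (\<Sum>r<m. ?l (Var_y r)) = ?l Var_x"
  have word: "word_monomial w = \<mu> \<longleftrightarrow> length w = ?l Var_x \<and> (\<forall>r. count_list w r = ?l (Var_y r))" for w
    by (auto simp: poly_mapping_eq_iff fun_eq_iff lookup_word_monomial split: gf_var.splits)
  show "F_H m H \<mu> = language_series (walks m H) \<mu>"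
  proof (cases ?cond)
    case True
    then have out: "?l (Var_y r) = 0" if "\<not> r < m" for r
      using that by (fastforce simp: gf_vars_def in_keys_iff)
    have "{w \<in> walks m H. word_monomial w = \<mu>} = ?A"
    proof (intro set_eqI)
      fix w
      have "count_list w r = ?l (Var_y r)" if "set w \<subseteq> {..<m}" "\<not> r < m" for r
        using that out by (metis count_notin lessThan_iff subsetD)
      then show "w \<in> {w \<in> walks m H. word_monomial w = \<mu>} \<longleftrightarrow> w \<in> ?A"
        using True by (auto simp: walks_def word successively_conv_nth in_lists_conv_set subset_iff)
    qed
    with True show ?thesis by (simp add: F_H_def A_H_def language_series_def)
  next
    case False
    \<comment> \<open>The weight of any walk meets the side condition, so outside it no walk is
      counted.\<close>
    have "word_monomial w \<noteq> \<mu>" if "w \<in> walks m H" for w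
    proof
      assume *: "word_monomial w = \<mu>"
      have w: "set w \<subseteq> {..<m}" "w \<noteq> []" using that by (auto simp: walks_def)
      have "v \<in> gf_vars m" if "v \<in> Poly_Mapping.keys \<mu>" for v
      proof (cases v)
        case (Var_y r)
        with that * word have "count_list w r \<noteq> 0" by (metis in_keys_iff)
        with w Var_y show ?thesis by (auto simp: gf_vars_def count_list_0_iff)
      qed (simp add: gf_vars_def)
      moreover have "?l Var_x = length w" "\<And>r. ?l (Var_y r) = count_list w r" using * word by auto
      moreover from w have "length w \<ge> 1" by (simp add: Suc_leI)
      ultimately have ?cond using sum_count_set[OF w(1)] by auto
      with False show False by contradiction
    qed
    then have "{w \<in> walks m H. word_monomial w = \<mu>} = {}" by auto
    then have "language_series (walks m H) \<mu> = 0" by (simp only: language_series_def) simp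
    with False show ?thesis unfolding F_H_def by (simp only: if_False)
  qed
qed

lemma rational_series_F_H: "rational_series (gf_vars m) (F_H m H)"
proof -
  define W where "W s = {w \<in> walks m H. hd w = s}" for s
  \<comment> \<open>The index \<open>m\<close> stands for the total series, which is the unknown to be solved for.\<close>
  define F where "F s = (if s < m then language_series (W s) else language_series (walks m H))" for s
  define M :: "nat \<Rightarrow> (gf_var \<Rightarrow>\<^sub>0 nat) \<Rightarrow>\<^sub>0 rat"
    where "M s = Poly_Mapping.single (letter_monomial s) 1" for s
  \<comment> \<open>Row \<open>s < m\<close> says that \<open>F s\<close> minus \<open>M s\<close>
    times the sum of \<open>F t\<close> over the successors \<open>t\<close> equals
    \<open>M s\<close>; row \<open>m\<close> says that \<open>F m\<close> is the sum of all
    \<open>F s\<close>. Only row \<open>m\<close> has non-zero constant terms off the diagonal, so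
    \<open>m\<close> takes the role of the exempt index \<open>z\<close> in the elimination.\<close>
  define N where "N s t = (if s < m
      then (if s = t then 1 else 0) - (if t < m \<and> (s, t) \<in> H then M s else 0)
      else if t < m then - 1 else 1)" for s t
  define b where "b s = (if s < m then M s else 0)" for s
  have W_lists: "W s \<subseteq> lists {..<m}" for s by (auto simp: W_def walks_def)
  have poly_1: "poly_in V 1" and poly_0: "poly_in V 0" for V :: "gf_var set"
    by (auto simp: poly_in_def)
  have poly_M: "poly_in (gf_vars m) (M s)" if "s < m" for s
    using that keys_add[of "Poly_Mapping.single Var_x (1::nat)" "Poly_Mapping.single (Var_y s) 1"]
    by (auto simp: poly_in_def M_def letter_monomial_def gf_vars_def)
  have M_0: "Poly_Mapping.lookup (M s) 0 = 0" for s
  proof -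
    have "Poly_Mapping.lookup (letter_monomial s) Var_x \<noteq> 0"
      by (simp add: letter_monomial_def lookup_add)
    then have "letter_monomial s \<noteq> 0" by (metis lookup_zero)
    then show ?thesis by (simp add: M_def lookup_single)
  qed
  \<comment> \<open>After its first letter, a walk from \<open>s\<close> is either over or continues
    as a walk from a successor of \<open>s\<close>. Since \<open>H\<close> is arbitrary here,
    \<open>t < m\<close> has to be required explicitly.\<close>
  have W_rec: "W s = Cons s ` ({[]} \<union> (\<Union>t\<in>{t. t < m \<and> (s, t) \<in> H}. W t))" if "s < m" for s
  proof (intro set_eqI)
    fix w
    have Cons_iff: "a # v \<in> Cons s ` A \<longleftrightarrow> a = s \<and> v \<in> A" for a v A by auto
    show "w \<in> W s \<longleftrightarrow> w \<in> Cons s ` ({[]} \<union> (\<Union>t\<in>{t. t < m \<and> (s, t) \<in> H}. W t))"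
    proof (cases w)
      case Nil
      then show ?thesis by (auto simp: W_def walks_def)
    next
      case (Cons a v)
      show ?thesis
        unfolding Cons Cons_iff
        using that by (cases v) (auto simp: W_def walks_def)
    qed
  qed
  have F_rec: "F s = poly_scale (M s) (Poly_Mapping.lookup 1 + (\<Sum>t | t < m \<and> (s, t) \<in> H. F t))"
    if "s < m" for s
  proof -
    have "F s = poly_scale (M s) (language_series ({[]} \<union> (\<Union>t\<in>{t. t < m \<and> (s, t) \<in> H}. W t)))"
      using that W_rec[OF that] by (simp only: F_def M_def language_series_Cons if_True)
    also have "language_series ({[]} \<union> (\<Union>t\<in>{t. t < m \<and> (s, t) \<in> H}. W t))
        = language_series {[]} + language_series (\<Union>t\<in>{t. t < m \<and> (s, t) \<in> H}. W t)"
      using W_lists by (intro language_series_Un[where m = m]) (auto simp: W_def walks_def)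
    also have "language_series (\<Union>t\<in>{t. t < m \<and> (s, t) \<in> H}. W t)
        = (\<Sum>t | t < m \<and> (s, t) \<in> H. language_series (W t))"
      using W_lists by (intro language_series_UN[where m = m]) (auto simp: W_def)
    finally show ?thesis by (simp add: language_series_Nil F_def plus_fun_def)
  qed
  have "walks m H = (\<Union>s<m. W s)"
  proof -
    have "hd w < m" if "w \<in> walks m H" for w
      using that by (cases w) (auto simp: walks_def)
    then show ?thesis by (auto simp: W_def)
  qed
  then have F_m: "F m = (\<Sum>s<m. F s)"
    using W_lists language_series_UN[of "{..<m}" W m] by (simp add: F_def W_def disjoint_iff)
  have "rational_series (gf_vars m) (F m)"
  proof (rule rational_series_linear_system[of "{..<m}" m _ N b])
    show "poly_in (gf_vars m) (N s t)" for s t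
      unfolding N_def using poly_M by (auto intro!: poly_in_diff poly_in_uminus poly_1 poly_0)
    show "poly_in (gf_vars m) (b s)" for s
      unfolding b_def using poly_M by (auto intro!: poly_0)
    show "Poly_Mapping.lookup (N s s) 0 \<noteq> 0" for s
      by (simp add: N_def lookup_minus M_0 lookup_one)
    show "Poly_Mapping.lookup (N s t) 0 = 0" if "s \<in> {..<m}" "s \<noteq> t" for s t
      using that by (simp add: N_def lookup_minus M_0)
    show "(\<Sum>t\<in>insert m {..<m}. poly_scale (N s t) (F t)) = Poly_Mapping.lookup (b s)"
      if "s \<in> insert m {..<m}" for s
    proof (cases "s < m")
      case True
      \<comment> \<open>The total series has coefficient 0 in this row, so its summand
        disappears.\<close>
      have "(\<Sum>t\<in>insert m {..<m}. poly_scale (N s t) (F t))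
          = (\<Sum>t<m. (if s = t then F t else 0) - (if (s, t) \<in> H then poly_scale (M s) (F t) else 0))"
        using True by (simp add: N_def mps.scale_left_diff_distrib) (auto intro!: sum.cong)
      also have "\<dots> = F s - (\<Sum>t | t < m \<and> (s, t) \<in> H. poly_scale (M s) (F t))"
        using True by (simp add: sum_subtractf sum.If_cases Collect_conj_eq lessThan_def)
      also have "\<dots> = poly_scale (M s) (Poly_Mapping.lookup 1)"
        by (subst F_rec[OF True]) (simp add: mps.scale_right_distrib mps.scale_sum_right)
      also have "\<dots> = Poly_Mapping.lookup (b s)"
        using True by (simp add: poly_scale_lookup b_def)
      finally show ?thesis .
    next
      case False
      with that show ?thesis
        by (simp add: N_def b_def F_m sum_negf fun_eq_iff)
    qed
  qed auto
  then show ?thesis by (simp add: F_def F_H_eq_language_series)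
qed

theorem theorem3p8:
  fixes m :: nat and X :: "(nat \<times> nat) set" and f :: "nat \<Rightarrow> nat \<Rightarrow> nat"
  assumes "m \<ge> 1"
    and "periodic_mod m X f"
  shows "(\<forall>n\<ge>1. d_X X {} n =
            A_H m (residue_digraph m f) (residue_count m n) * (\<Prod>r<m. fact (residue_count m n r)))
       \<and> rational_series (gf_vars m) (F_H m (residue_digraph m f))"
  using d_X_empty_eq[OF assms] rational_series_F_H by blast

end
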